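(* Let $\Gamma$ be a connected simplicial graph, $Y$ a rigid set of $\Gamma$, and $\varphi : Y^\infty\to\Gamma$ an edge-preserving map such that $\varphi|_Y$ is locally injective. Then $\varphi$ is the restriction to $Y^\infty$ of an automorphism of $\Gamma$, unique up to the pointwise stabilizer of $Y$ in $\mathrm{Aut}(\Gamma)$.
   Context: For a simplicial graph $\Gamma$, $\mathcal{V}(\Gamma)$ denotes its vertex set, and the link of a vertex $w$ is the full subgraph spanned by the vertices adjacent to $w$. A vertex $v$ is uniquely determined by $B\subset\mathcal{V}(\Gamma)$, written $v=\langle B\rangle$, if $\{v\}=\bigcap_{w\in B}\mathrm{link}(w)$ (as vertex sets). For a full subgraph $Y$ of $\Gamma$, the first rigid expansion $Y^1$ is the full subgraph spanned by $\mathcal{V}(Y)\cup\{v : v=\langle B\rangle,\ B\subset\mathcal{V}(Y)\}$; set $Y^0=Y$, $Y^k=(Y^{k-1})^1$, and let $Y^\infty$ be the full subgraph spanned by $\bigcup_{i\in\mathbb{N}}\mathcal{V}(Y^i)$. An edge-preserving map is a graph homomorphism: a map on vertices sending adjacent vertices to adjacent vertices. A simplicial map sends vertices to vertices and adjacent vertices to adjacent or equal vertices. The star of $v$ is the subgraph whose vertices are $v$ and all vertices adjacent to $v$ and whose edges are those with endpoint $v$. A simplicial map $\varphi:Y\to\Gamma$ from a full subgraph is locally injective if $\varphi|_{\mathrm{star}(v)\cap Y}$ is injective for all $v\in\mathcal{V}(Y)$. A rigid set of $\Gamma$ is a full subgraph $Y$ such that every locally injective simplicial map $Y\to\Gamma$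 is the restriction to $Y$ of an automorphism of $\Gamma$, unique up to the pointwise stabilizer $\mathrm{stab}_{pt}(Y)$ of $Y$ in $\mathrm{Aut}(\Gamma)$. "Unique up to $\mathrm{stab}_{pt}(Y)$" means two such automorphisms $\phi,\psi$ satisfy $\phi^{-1}\psi\in\mathrm{stab}_{pt}(Y)$. *)

theory Defs
  imports "Graph_Theory.Digraph_Component" "HOL-Algebra.Bij"
begin

text \<open>
  An undirected edge is represented by a pair of opposite arcs. Vertex and edge sets may be
  infinite, so the locale \<^locale>\<open>graph\<close>, which demands finiteness, does not apply.
\<close>

locale simplicial_graph = sym_digraph + loopfree_digraph + nomulti_digraph

subsection \<open>Links, stars and rigid expansions\<close>

definition link :: "('a, 'b) pre_digraph \<Rightarrow> 'a \<Rightarrow> ('a, 'b) pre_digraph" where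
  "link G w = G \<restriction> {v \<in> verts G. w \<rightarrow>\<^bsub>G\<^esub> v}"

definition star :: "('a, 'b) pre_digraph \<Rightarrow> 'a \<Rightarrow> ('a, 'b) pre_digraph" where
  "star G v = \<lparr> verts = insert v {u \<in> verts G. v \<rightarrow>\<^bsub>G\<^esub> u},
     arcs = {e \<in> arcs G. tail G e = v \<or> head G e = v}, tail = tail G, head = head G \<rparr>"

text \<open>The intersection is taken inside the vertex set, so that for \<open>B = {}\<close> it is \<open>verts G\<close>.\<close>

definition uniquely_determined :: "('a, 'b) pre_digraph \<Rightarrow> 'a \<Rightarrow> 'a set \<Rightarrow> bool" where
  "uniquely_determined G v B \<longleftrightarrow>
     B \<subseteq> verts G \<and> {v} = verts G \<inter> (\<Inter>w\<in>B. verts (link G w))"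

definition first_rigid_expansion ::
    "('a, 'b) pre_digraph \<Rightarrow> ('a, 'b) pre_digraph \<Rightarrow> ('a, 'b) pre_digraph" where
  "first_rigid_expansion G Y =
     G \<restriction> (verts Y \<union> {v. \<exists>B. B \<subseteq> verts Y \<and> uniquely_determined G v B})"

definition rigid_expansion ::
    "('a, 'b) pre_digraph \<Rightarrow> ('a, 'b) pre_digraph \<Rightarrow> nat \<Rightarrow> ('a, 'b) pre_digraph" where
  "rigid_expansion G Y k = (first_rigid_expansion G ^^ k) Y"

definition rigid_expansion_infinity ::
    "('a, 'b) pre_digraph \<Rightarrow> ('a, 'b) pre_digraph \<Rightarrow> ('a, 'b) pre_digraph" where
  "rigid_expansion_infinity G Y = G \<restriction> (\<Union>i. verts (rigid_expansion G Y i))"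

subsection \<open>Maps\<close>

text \<open>
  A map of graphs \<open>Y \<rightarrow> G\<close> is a function on the vertex type of which only the values on
  \<open>verts Y\<close> matter; restricting it to a subgraph therefore leaves the function unchanged.
\<close>

definition edge_preserving ::
    "('a, 'b) pre_digraph \<Rightarrow> ('c, 'd) pre_digraph \<Rightarrow> ('a \<Rightarrow> 'c) \<Rightarrow> bool" where
  "edge_preserving Y G \<phi> \<longleftrightarrow>
     \<phi> ` verts Y \<subseteq> verts G \<and>
     (\<forall>u\<in>verts Y. \<forall>v\<in>verts Y. u \<rightarrow>\<^bsub>Y\<^esub> v \<longrightarrow> \<phi> u \<rightarrow>\<^bsub>G\<^esub> \<phi> v)"

definition simplicial_map ::
    "('a, 'b) pre_digraph \<Rightarrow> ('c, 'd) pre_digraph \<Rightarrow> ('a \<Rightarrow> 'c) \<Rightarrow> bool" where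
  "simplicial_map Y G \<phi> \<longleftrightarrow>
     \<phi> ` verts Y \<subseteq> verts G \<and>
     (\<forall>u\<in>verts Y. \<forall>v\<in>verts Y. u \<rightarrow>\<^bsub>Y\<^esub> v \<longrightarrow> \<phi> u \<rightarrow>\<^bsub>G\<^esub> \<phi> v \<or> \<phi> u = \<phi> v)"

text \<open>
  Injectivity is required on vertices only: in a simplicial graph an edge is determined by its
  endpoints, so injectivity on edges follows.
\<close>

definition locally_injective ::
    "('a, 'b) pre_digraph \<Rightarrow> ('a, 'b) pre_digraph \<Rightarrow> ('a \<Rightarrow> 'a) \<Rightarrow> bool" where
  "locally_injective G Y \<phi> \<longleftrightarrow>
     simplicial_map Y G \<phi> \<and>
     (\<forall>v\<in>verts Y. inj_on \<phi> (verts (star G v) \<inter> verts Y))"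

subsection \<open>Automorphisms and rigid sets\<close>

definition graph_Aut :: "('a, 'b) pre_digraph \<Rightarrow> ('a \<Rightarrow> 'a) monoid" where
  "graph_Aut G = (BijGroup (verts G))
     \<lparr>carrier := {f \<in> Bij (verts G).
        \<forall>u\<in>verts G. \<forall>v\<in>verts G. f u \<rightarrow>\<^bsub>G\<^esub> f v \<longleftrightarrow> u \<rightarrow>\<^bsub>G\<^esub> v}\<rparr>"

lemma subgroup_graph_Aut: "subgroup (carrier (graph_Aut G)) (BijGroup (verts G))"
proof -
  interpret group "BijGroup (verts G)" by (rule group_BijGroup)
  show ?thesis
  proof (rule subgroupI)
    show "carrier (graph_Aut G) \<subseteq> carrier (BijGroup (verts G))"
      by (auto simp: graph_Aut_def BijGroup_def)
    show "carrier (graph_Aut G) \<noteq> {}"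
    proof -
      have "(\<lambda>x\<in>verts G. x) \<in> carrier (graph_Aut G)"
        by (simp add: graph_Aut_def id_Bij)
      then show ?thesis by blast
    qed
  next
    fix f assume f: "f \<in> carrier (graph_Aut G)"
    then have bij: "f \<in> Bij (verts G)" by (simp add: graph_Aut_def)
    have "inv_into (verts G) f u \<rightarrow>\<^bsub>G\<^esub> inv_into (verts G) f v \<longleftrightarrow> u \<rightarrow>\<^bsub>G\<^esub> v"
      if "u \<in> verts G" "v \<in> verts G" for u v
    proof -
      have right: "f (inv_into (verts G) f x) = x" if "x \<in> verts G" for x
        using bij that by (auto simp: Bij_def intro: bij_betw_inv_into_right)
      have mem: "inv_into (verts G) f x \<in> verts G" if "x \<in> verts G" for x
        using bij that by (rule Bij_inv_into_mem)
      have "f (inv_into (verts G) f u) \<rightarrow>\<^bsub>G\<^esub> f (inv_into (verts G) f v) \<longleftrightarrow>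
          inv_into (verts G) f u \<rightarrow>\<^bsub>G\<^esub> inv_into (verts G) f v"
        using f mem[OF that(1)] mem[OF that(2)] by (simp add: graph_Aut_def)
      then show ?thesis by (simp only: right that)
    qed
    with bij show "inv\<^bsub>BijGroup (verts G)\<^esub> f \<in> carrier (graph_Aut G)"
      by (simp add: graph_Aut_def inv_BijGroup restrict_inv_into_Bij)
  next
    fix f g assume f: "f \<in> carrier (graph_Aut G)" and g: "g \<in> carrier (graph_Aut G)"
    then have bij: "f \<in> Bij (verts G)" "g \<in> Bij (verts G)" by (simp_all add: graph_Aut_def)
    then have "g x \<in> verts G" if "x \<in> verts G" for x
      using that Bij_imp_funcset by blast
    with f g bij show "f \<otimes>\<^bsub>BijGroup (verts G)\<^esub> g \<in> carrier (graph_Aut G)"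
      by (simp add: graph_Aut_def BijGroup_def compose_Bij compose_eq)
  qed
qed

lemma group_graph_Aut: "group (graph_Aut G)"
proof -
  interpret group "BijGroup (verts G)" by (rule group_BijGroup)
  have "graph_Aut G = (BijGroup (verts G))\<lparr>carrier := carrier (graph_Aut G)\<rparr>"
    by (simp add: graph_Aut_def)
  with subgroup_imp_group[OF subgroup_graph_Aut] show ?thesis by metis
qed

definition stab_pt :: "('a, 'b) pre_digraph \<Rightarrow> ('a, 'b) pre_digraph \<Rightarrow> ('a \<Rightarrow> 'a) set" where
  "stab_pt G Y = {f \<in> carrier (graph_Aut G). \<forall>v\<in>verts Y. f v = v}"

definition is_restriction ::
    "('a, 'b) pre_digraph \<Rightarrow> ('a \<Rightarrow> 'a) \<Rightarrow> ('a \<Rightarrow> 'a) \<Rightarrow> bool" where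
  "is_restriction Z \<phi> f \<longleftrightarrow> (\<forall>v\<in>verts Z. \<phi> v = f v)"

definition rigid_set :: "('a, 'b) pre_digraph \<Rightarrow> ('a, 'b) pre_digraph \<Rightarrow> bool" where
  "rigid_set G Y \<longleftrightarrow>
     induced_subgraph Y G \<and>
     (\<forall>\<phi>. locally_injective G Y \<phi> \<longrightarrow>
        (\<exists>f\<in>carrier (graph_Aut G). is_restriction Y \<phi> f) \<and>
        (\<forall>f\<in>carrier (graph_Aut G). \<forall>g\<in>carrier (graph_Aut G).
           is_restriction Y \<phi> f \<and> is_restriction Y \<phi> g \<longrightarrow>
           inv\<^bsub>graph_Aut G\<^esub> f \<otimes>\<^bsub>graph_Aut G\<^esub> g \<in> stab_pt G Y))"

end

theory Submission
  imports Defs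
begin

text \<open>
  An automorphism \<open>f\<close> that agrees with \<open>\<phi>\<close> on \<open>Y\<close> agrees with it on every \<open>Y\<^sup>k\<close>: if
  \<open>v = \<langle>B\<rangle>\<close> with \<open>B \<subseteq> Y\<^sup>k\<close>, then \<open>\<phi> v\<close> is adjacent to \<open>\<phi> w = f w\<close> for all \<open>w \<in> B\<close>, so the
  \<open>f\<close>-preimage of \<open>\<phi> v\<close> lies in the link of every \<open>w \<in> B\<close> and is therefore \<open>v\<close>.
\<close>

lemma dominates_induce_subgraphI:
  assumes "u \<rightarrow>\<^bsub>G\<^esub> v" "u \<in> V" "v \<in> V"
  shows "u \<rightarrow>\<^bsub>G \<restriction> V\<^esub> v"
  using assms by (fastforce simp: arcs_ends_def arc_to_ends_def)

lemma dominates_if_uniquely_determined: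
  assumes "uniquely_determined G v B" "w \<in> B"
  shows "w \<rightarrow>\<^bsub>G\<^esub> v"
  using assms unfolding uniquely_determined_def link_def by auto

text \<open>For \<open>B = {}\<close> the intersection of links is read as all of
  \<open>verts G\<close>, so membership of \<open>u\<close> is supplied separately from
  adjacency.\<close>

lemma eq_if_uniquely_determined:
  assumes "uniquely_determined G v B" "u \<in> verts G" "\<And>w. w \<in> B \<Longrightarrow> w \<rightarrow>\<^bsub>G\<^esub> u"
  shows "u = v"
proof -
  have "u \<in> verts G \<inter> (\<Inter>w\<in>B. verts (link G w))"
    using assms by (auto simp: link_def)
  with assms(1) show ?thesis unfolding uniquely_determined_def by blast
qed

text \<open>The vertex \<open>x\<close> is left arbitrary; the induction below puts
  \<open>\<phi> v\<close> for it, known only to be a vertex adjacent to every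
  \<open>f w\<close>.\<close>

lemma uniquely_determined_image_eq:
  assumes "f \<in> carrier (graph_Aut G)" "uniquely_determined G v B"
    and "x \<in> verts G" "\<And>w. w \<in> B \<Longrightarrow> f w \<rightarrow>\<^bsub>G\<^esub> x"
  shows "f v = x"
proof -
  have "f ` verts G = verts G"
    using assms(1) by (simp add: graph_Aut_def Bij_def bij_betw_def)
  with \<open>x \<in> verts G\<close> obtain u where u: "u \<in> verts G" "x = f u" by blast
  \<comment> \<open>Automorphisms also reflect adjacency, so an edge from \<open>f w\<close> to
    \<open>f u\<close> comes from one between \<open>w\<close> and \<open>u\<close>.\<close>
  have "w \<rightarrow>\<^bsub>G\<^esub> u" if "w \<in> B" for w
  proof -
    have "w \<in> verts G" using assms(2) that by (auto simp: uniquely_determined_def)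
    with assms(1) assms(4)[OF that] u show ?thesis by (simp add: graph_Aut_def)
  qed
  with assms(2) u show ?thesis using eq_if_uniquely_determined by metis
qed

lemma verts_rigid_expansion_subset_infinity:
  "verts (rigid_expansion G Y k) \<subseteq> verts (rigid_expansion_infinity G Y)"
  by (auto simp: rigid_expansion_infinity_def)

lemma is_restriction_rigid_expansion:
  assumes "f \<in> carrier (graph_Aut G)" "is_restriction Y \<phi> f"
    and "edge_preserving (rigid_expansion_infinity G Y) G \<phi>"
  shows "is_restriction (rigid_expansion G Y k) \<phi> f"
proof (induction k)
  case 0
  with assms(2) show ?case by (simp add: rigid_expansion_def)
next
  case (Suc k)
  let ?Z = "rigid_expansion G Y k" and ?I = "rigid_expansion_infinity G Y"
  have exp: "rigid_expansion G Y (Suc k) = first_rigid_expansion G ?Z"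
    by (simp add: rigid_expansion_def)
  have "\<phi> v = f v" if v: "v \<in> verts (rigid_expansion G Y (Suc k))"
    and B: "B \<subseteq> verts ?Z" "uniquely_determined G v B" for v B
  proof (rule uniquely_determined_image_eq[OF assms(1) B(2), symmetric])
    from v have vI: "v \<in> verts ?I"
      by (rule subsetD[OF verts_rigid_expansion_subset_infinity])
    then show "\<phi> v \<in> verts G"
      using assms(3) by (auto simp: edge_preserving_def)
    fix w assume "w \<in> B"
    then have wZ: "w \<in> verts ?Z" using B(1) by blast
    then have wI: "w \<in> verts ?I"
      by (rule subsetD[OF verts_rigid_expansion_subset_infinity])
    \<comment> \<open>This edge of the ambient graph lies in \<open>?I\<close> because
      \<open>?I\<close> is a full subgraph. Being edge-preserving, \<open>\<phi>\<close> cannot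
      collapse it, as a simplicial map might.\<close>
    have "w \<rightarrow>\<^bsub>?I\<^esub> v"
      using dominates_if_uniquely_determined[OF B(2) \<open>w \<in> B\<close>] vI wI
      unfolding rigid_expansion_infinity_def
      by (intro dominates_induce_subgraphI) simp_all
    then have "\<phi> w \<rightarrow>\<^bsub>G\<^esub> \<phi> v"
      using assms(3) vI wI by (simp add: edge_preserving_def)
    then show "f w \<rightarrow>\<^bsub>G\<^esub> \<phi> v"
      using Suc.IH wZ by (simp add: is_restriction_def)
  qed
  \<comment> \<open>A vertex of the next stage is either already in \<open>?Z\<close> or determined
    by some \<open>B\<close> inside \<open>?Z\<close>.\<close>
  with Suc.IH show ?case
    by (auto simp: is_restriction_def exp first_rigid_expansion_def)
qed

text \<open>This carries both existence and uniqueness of the automorphism over from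
  \<open>Y\<close>, where rigidity provides them.\<close>

lemma is_restriction_rigid_expansion_infinity_iff:
  assumes "f \<in> carrier (graph_Aut G)"
    and "edge_preserving (rigid_expansion_infinity G Y) G \<phi>"
  shows "is_restriction (rigid_expansion_infinity G Y) \<phi> f \<longleftrightarrow> is_restriction Y \<phi> f"
proof
  assume "is_restriction (rigid_expansion_infinity G Y) \<phi> f"
  then show "is_restriction Y \<phi> f"
    \<comment> \<open>Stage \<open>0\<close> is \<open>Y\<close> itself.\<close>
    using verts_rigid_expansion_subset_infinity[of G Y 0]
    by (auto simp: is_restriction_def rigid_expansion_def)
next
  assume "is_restriction Y \<phi> f"
  from is_restriction_rigid_expansion[OF assms(1) this assms(2)]
  show "is_restriction (rigid_expansion_infinity G Y) \<phi> f"
    by (auto simp: is_restriction_def rigid_expansion_infinity_def)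
qed

theorem corollary3:
  fixes G Y :: "('a, 'b) pre_digraph" and \<phi> :: "'a \<Rightarrow> 'a"
  assumes "simplicial_graph G" and "connected G"
    and "rigid_set G Y"
    and "edge_preserving (rigid_expansion_infinity G Y) G \<phi>"
    and "locally_injective G Y \<phi>"
  shows "(\<exists>f\<in>carrier (graph_Aut G). is_restriction (rigid_expansion_infinity G Y) \<phi> f) \<and>
    (\<forall>f\<in>carrier (graph_Aut G). \<forall>g\<in>carrier (graph_Aut G).
       is_restriction (rigid_expansion_infinity G Y) \<phi> f \<and>
       is_restriction (rigid_expansion_infinity G Y) \<phi> g \<longrightarrow>
       inv\<^bsub>graph_Aut G\<^esub> f \<otimes>\<^bsub>graph_Aut G\<^esub> g \<in> stab_pt G Y)"
  \<comment> \<open>Rigidity is instantiated at \<open>\<phi>\<close>, viewed as a map on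
    \<open>Y\<close>.\<close>
  using assms(3,5)
  by (simp add: rigid_set_def is_restriction_rigid_expansion_infinity_iff[OF _ assms(4)])

end
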